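(* Let $S(t)$ be a $C^1$ curve in $CS^d_n$ defined on an interval $I$ and let $t^*\in I$. Let $\Omega$ be an open set in $\mathbb{R}^d$ with $\sigma(S(t))\subset\Omega$ for all $t\in I$, let $f\in C^1(\Omega,\mathbb{R})$, and let $F$ be the matrix function induced by $f$. Let $U$ be a unitary matrix diagonalizing every component of $S(t^* )$, chosen so that repeated joint eigenvalues appear consecutively, and let $$D^r:=U^*S^r(t^* )U=\operatorname{diag}(x^r_1,\dots,x^r_n),\qquad \Gamma^r:=U^*(S^r)'(t^* )U\qquad(1\le r\le d),$$ so that the joint eigenvalues of $S(t^* )$ are $x_i=(x_i^1,\dots,x_i^d)$, $1\le i\le n$. Define the matrices $$\tilde\Gamma^r_{ij}:=\begin{cases}\Gamma^r_{ij}&\text{if }x_i=x_j\\0&\text{otherwise,}\end{cases}\qquad Y_{ij}:=\begin{cases}\dfrac{\Gamma^q_{ij}}{x^q_j-x^q_i}&\text{if }x_i\ne x_j\\0&\text{otherwise,}\end{cases}$$ where, for each $(i,j)$ with $x_i\neq x_j$, $q$ is chosen so that $x_j^q-x_i^q\ne0$. Then $$\tfrac{d}{dt}F(S(t))|_{t=t^*}=U\Big(\sum_{r=1}^d\tilde\Gamma^r\,\tfrac{\partial f}{\partial x^r}(D)+[Y,F(D)]\Big)U^*.$$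
   Context: $CS^d_n$ is the set of $d$-tuples $S=(S^1,\dots,S^d)$ of pairwise-commuting $n\times n$ self-adjoint (complex Hermitian) matrices; a curve in $CS^d_n$ is $C^1$ if it is continuously differentiable as a map into the space of $d$-tuples of self-adjoint matrices. For $S\in CS^d_n$ there is a unitary $U$ with $S^r=U\operatorname{diag}(x_1^r,\dots,x_n^r)U^*$ for all $1\le r\le d$; the joint eigenvalues are $x_i=(x_i^1,\dots,x_i^d)$ and the joint spectrum is $\sigma(S):=\{x_i:1\le i\le n\}\subset\mathbb{R}^d$. A function $f:\Omega\to\mathbb{R}$ induces the matrix function $F(S):=U\operatorname{diag}(f(x_1),\dots,f(x_n))U^*$ for $S\in CS^d_n$ with $\sigma(S)\subset\Omega$. In particular, for $D=(D^1,\dots,D^d)$ diagonal, $F(D)=\operatorname{diag}(f(x_1),\dots,f(x_n))$, and $\frac{\partial f}{\partial x^r}(D):=\operatorname{diag}\big(\frac{\partial f}{\partial x^r}(x_1),\dots,\frac{\partial f}{\partial x^r}(x_n)\big)$. $[A,B]=AB-BA$. Superscripts $r,q$ index components (they are not powers). *)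

theory Defs
  imports "HOL-Analysis.Analysis"
begin

text \<open>
  A \<open>d\<close>-tuple of complex \<open>n \<times> n\<close> matrices is an element of \<^typ>\<open>(complex^'n^'n)^'d\<close>,
  which carries the Euclidean topology; points of \<open>d\<close>-dimensional space are elements of
  \<^typ>\<open>real^'d\<close>.
\<close>

definition adj :: "complex^'n^'m \<Rightarrow> complex^'m^'n" where
  "adj A = (\<chi> i j. cnj (A $ j $ i))"

definition self_adjoint :: "complex^'n^'n \<Rightarrow> bool" where
  "self_adjoint A \<longleftrightarrow> adj A = A"

definition unitary :: "complex^'n^'n \<Rightarrow> bool" where
  "unitary U \<longleftrightarrow> adj U ** U = mat 1 \<and> U ** adj U = mat 1"

definition diag :: "('n \<Rightarrow> real) \<Rightarrow> complex^'n^'n" where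
  "diag a = (\<chi> i j. if i = j then complex_of_real (a i) else 0)"

definition commutator :: "complex^'n^'n \<Rightarrow> complex^'n^'n \<Rightarrow> complex^'n^'n" where
  "commutator A B = A ** B - B ** A"

definition CS :: "((complex^'n^'n)^'d) set" where
  "CS = {S. (\<forall>r. self_adjoint (S $ r)) \<and> (\<forall>r q. S $ r ** S $ q = S $ q ** S $ r)}"

text \<open>
  Derivatives are taken within \<open>I\<close>, hence are one-sided at an end point belonging to \<open>I\<close>.
\<close>

definition C1_curve_on :: "(real \<Rightarrow> 'a::real_normed_vector) \<Rightarrow> real set \<Rightarrow> bool" where
  "C1_curve_on S I \<longleftrightarrow>
     (\<exists>S'. (\<forall>t\<in>I. (S has_vector_derivative S' t) (at t within I)) \<and> continuous_on I S')"

text \<open>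
  \<open>U\<close> diagonalizes all components of \<open>S\<close> simultaneously, \<open>x i\<close> being the joint eigenvalue
  belonging to the \<open>i\<close>-th column of \<open>U\<close>.
\<close>

definition joint_diagonalization ::
    "(complex^'n^'n)^'d \<Rightarrow> complex^'n^'n \<Rightarrow> ('n \<Rightarrow> real^'d) \<Rightarrow> bool" where
  "joint_diagonalization S U x \<longleftrightarrow>
     unitary U \<and> (\<forall>r. S $ r = U ** diag (\<lambda>i. x i $ r) ** adj U)"

text \<open>
  A joint diagonalization exists for every \<open>S \<in> CS\<close> by the spectral theorem.  The joint
  spectrum and the induced matrix function do not depend on which one is used; see \<open>joint_spectrum_eq\<close> and \<open>matrix_function_eq\<close> below.
\<close>

definition joint_spectrum :: "(complex^'n^'n)^'d \<Rightarrow> (real^'d) set" where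
  "joint_spectrum S = (THE \<sigma>. \<exists>U x. joint_diagonalization S U x \<and> \<sigma> = range x)"

definition matrix_function ::
    "(real^'d \<Rightarrow> real) \<Rightarrow> (complex^'n^'n)^'d \<Rightarrow> complex^'n^'n" where
  "matrix_function f S =
     (THE M. \<exists>U x. joint_diagonalization S U x \<and> M = U ** diag (\<lambda>i. f (x i)) ** adj U)"

definition C1_on :: "(real^'d \<Rightarrow> real) \<Rightarrow> (real^'d) set \<Rightarrow> bool" where
  "C1_on f \<Omega> \<longleftrightarrow>
     (\<exists>f' :: real^'d \<Rightarrow> ((real^'d) \<Rightarrow>\<^sub>L real).
        (\<forall>x\<in>\<Omega>. (f has_derivative blinfun_apply (f' x)) (at x)) \<and> continuous_on \<Omega> f')"

definition partial_deriv :: "'d \<Rightarrow> (real^'d \<Rightarrow> real) \<Rightarrow> real^'d \<Rightarrow> real" where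
  "partial_deriv r f x = deriv (\<lambda>h. f (x + h *\<^sub>R axis r 1)) 0"

lemma matrix_mult_diag_right: "(A ** diag a) $ i $ j = A $ i $ j * complex_of_real (a j)"
  by (simp add: matrix_matrix_mult_def diag_def if_distrib cong: if_cong)

lemma matrix_mult_diag_left: "(diag a ** A) $ i $ j = complex_of_real (a i) * A $ i $ j"
  by (simp add: matrix_matrix_mult_def diag_def if_distrib if_distribR cong: if_cong)

lemma joint_diagonalization_intertwine:
  assumes "joint_diagonalization S U x" and "joint_diagonalization S V y"
    and "(adj V ** U) $ i $ j \<noteq> 0"
  shows "y i = x j"
proof -
  have U: "adj U ** U = mat 1" and V: "adj V ** V = mat 1"
    using assms(1,2) by (auto simp: joint_diagonalization_def unitary_def)
  have "y i $ r = x j $ r" for r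
  proof -
    have "U ** diag (\<lambda>i. x i $ r) ** adj U = V ** diag (\<lambda>i. y i $ r) ** adj V"
      using assms(1,2) by (metis joint_diagonalization_def)
    then have "adj V ** (U ** diag (\<lambda>i. x i $ r) ** adj U) ** U
        = adj V ** (V ** diag (\<lambda>i. y i $ r) ** adj V) ** U"
      by simp
    then have "adj V ** U ** diag (\<lambda>i. x i $ r) = diag (\<lambda>i. y i $ r) ** (adj V ** U)"
      by (metis U V matrix_mul_assoc matrix_mul_lid matrix_mul_rid)
    then have "(adj V ** U) $ i $ j * complex_of_real (x j $ r)
        = complex_of_real (y i $ r) * (adj V ** U) $ i $ j"
      by (metis matrix_mult_diag_left matrix_mult_diag_right)
    with assms(3) show ?thesis
      by simp
  qed
  then show ?thesis
    by (simp add: vec_eq_iff)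
qed

lemma joint_diagonalization_function_unique:
  assumes "joint_diagonalization S U x" and "joint_diagonalization S V y"
  shows "U ** diag (\<lambda>i. f (x i)) ** adj U = V ** diag (\<lambda>i. f (y i)) ** adj V"
proof -
  have U: "U ** adj U = mat 1" and V: "V ** adj V = mat 1"
    using assms by (auto simp: joint_diagonalization_def unitary_def)
  have "(adj V ** U ** diag (\<lambda>i. f (x i))) $ i $ j
      = (diag (\<lambda>i. f (y i)) ** (adj V ** U)) $ i $ j" for i j
    using joint_diagonalization_intertwine[OF assms, of i j]
    by (cases "(adj V ** U) $ i $ j = 0")
      (simp_all add: matrix_mult_diag_left matrix_mult_diag_right)
  then have "adj V ** U ** diag (\<lambda>i. f (x i)) = diag (\<lambda>i. f (y i)) ** (adj V ** U)"
    by (simp add: vec_eq_iff)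
  then have "V ** (adj V ** U ** diag (\<lambda>i. f (x i))) ** adj U
      = V ** (diag (\<lambda>i. f (y i)) ** (adj V ** U)) ** adj U"
    by simp
  then show ?thesis
    by (metis U V matrix_mul_assoc matrix_mul_lid matrix_mul_rid)
qed

lemma joint_diagonalization_range_subset:
  assumes "joint_diagonalization S U x" and "joint_diagonalization S V y"
  shows "range x \<subseteq> range y"
proof
  fix v assume "v \<in> range x"
  then obtain j where v: "v = x j" by blast
  have "V ** adj V = mat 1" and U: "adj U ** U = mat 1"
    using assms by (auto simp: joint_diagonalization_def unitary_def)
  then have UV: "(adj U ** V) ** (adj V ** U) = mat 1"
    by (metis matrix_mul_assoc matrix_mul_rid)
  have "\<exists>i. (adj V ** U) $ i $ j \<noteq> 0"
  proof (rule ccontr)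
    assume "\<nexists>i. (adj V ** U) $ i $ j \<noteq> 0"
    then have "((adj U ** V) ** (adj V ** U)) $ j $ j = 0"
      by (simp add: matrix_matrix_mult_def[of "adj U ** V"])
    with UV show False
      by (simp add: mat_def)
  qed
  then show "v \<in> range y"
    using joint_diagonalization_intertwine[OF assms] v by (metis rangeI)
qed

lemma joint_spectrum_eq:
  assumes "joint_diagonalization S U x"
  shows "joint_spectrum S = range x"
  unfolding joint_spectrum_def
  using assms joint_diagonalization_range_subset by (intro the_equality) blast+

lemma matrix_function_eq:
  assumes "joint_diagonalization S U x"
  shows "matrix_function f S = U ** diag (\<lambda>i. f (x i)) ** adj U"
  unfolding matrix_function_def
  using assms joint_diagonalization_function_unique by (intro the_equality) blast+

end

theory Submission
  imports Defs
begin

text \<open>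
  The matrix function is Frechet differentiable on \<^const>\<open>CS\<close> at every tuple whose joint
  eigenvalues are points of differentiability of \<open>f\<close>; the formula for a curve is then the chain
  rule.  Everything is conjugated by \<open>U\<close>, so that the base point is a diagonal tuple \<open>D\<close> with joint
  eigenvalues \<open>x i\<close>.

  The eigenvectors of a nearby tuple \<open>T\<close> need not depend continuously on \<open>T\<close>, so no eigenvectors
  are differentiated.  Instead, let \<open>T\<close> be diagonalized by a unitary \<open>W\<close> with joint eigenvalues
  \<open>y j\<close> (\<open>CS_joint_diagonalization_exists\<close>).  For every function \<open>g\<close>, the \<open>(a, b)\<close> entry of
  \<open>g(T) - g(D)\<close> is
  \<open>\<Sum>j. W $ a $ j * cnj (W $ b $ j) * (g (y j) - g (x a))\<close>.
  Applying this to the coordinate functions shows that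
  \<open>cmod (W $ a $ j) * norm (y j - x a)\<close> is bounded by a multiple of \<open>norm (T - D)\<close>: an
  eigenvector of \<open>T\<close> has a small component along every coordinate whose eigenvalue is not close
  to its own.  This quantitative fact replaces any control of the individual eigenvectors.

  If \<open>x a = x b\<close>, subtract from the identity for \<open>f\<close> its linear combination of the identities for
  the coordinate functions with coefficients the partial derivatives at \<open>x a\<close>.  What remains is
  the same sum with the Taylor remainder \<open>R\<close> of \<open>f\<close> at \<open>x a\<close>, and it is \<open>o(norm (T - D))\<close>: for
  \<open>y j\<close> near \<open>x a\<close> because \<open>R\<close> is small there compared with \<open>norm (y j - x a)\<close>, and for the other
  \<open>j\<close> because both weights are \<open>O(norm (T - D))\<close> (\<open>spectral_sum_small\<close>).  Hence the derivative of
  this entry is \<open>\<Sum>r. H $ r $ a $ b * p r a\<close>.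

  If \<open>x a \<noteq> x b\<close>, the entry is determined by the fact that \<open>f(T)\<close> commutes with \<open>T $ q\<close>:
  expanding the commutation relation around \<open>D\<close> gives
  \<open>G $ a $ b * (x b $ q - x a $ q) = H $ a $ b * (f (x b) - f (x a)) + (H ** G - G ** H) $ a $ b\<close>
  with \<open>G = f(T) - f(D)\<close> and \<open>H = (T - D) $ q\<close>.  The last term is \<open>o(norm (T - D))\<close> once \<open>G\<close> is known to
  tend to zero, which is the order-zero case of the same estimate.
\<close>

section \<open>Joint diagonalization of commuting self-adjoint tuples\<close>

text \<open>
  A unit vector of \<open>W\<close> maximizing the quadratic form of \<open>T\<close> is an eigenvector.
\<close>

lemma symmetric_operator_has_eigenvector:
  fixes T :: "'a::euclidean_space \<Rightarrow> 'a"
  assumes T: "linear T" and sym: "\<And>v w. T v \<bullet> w = v \<bullet> T w"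
    and W: "subspace W" "W \<noteq> {0}" and inv: "\<And>v. v \<in> W \<Longrightarrow> T v \<in> W"
  shows "\<exists>v\<in>W. v \<noteq> 0 \<and> (\<exists>l. T v = l *\<^sub>R v)"
proof -
  define K where "K = sphere 0 1 \<inter> W"
  obtain w where w: "w \<in> W" "w \<noteq> 0"
    using W subspace_0 by blast
  then have "(1 / norm w) *\<^sub>R w \<in> K"
    using W by (simp add: K_def subspace_scale)
  moreover have "compact K"
    unfolding K_def using W by (intro compact_Int_closed closed_subspace) auto
  moreover have "continuous_on K (\<lambda>v. T v \<bullet> v)"
    using T by (intro continuous_intros linear_continuous_on) (simp add: linear_linear)
  ultimately obtain v where v: "v \<in> K" and max: "\<And>u. u \<in> K \<Longrightarrow> T u \<bullet> u \<le> T v \<bullet> v"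
    using continuous_attains_sup[of K "\<lambda>v. T v \<bullet> v"] by blast
  have vW: "v \<in> W" and vv: "v \<bullet> v = 1"
    using v by (auto simp: K_def norm_eq_1)
  define l where "l = T v \<bullet> v"
  define N where "N = (\<lambda>u. l *\<^sub>R u - T u)"
  have N: "linear N"
    unfolding N_def using T by (intro linear_compose_sub linear_compose_scale_right linear_ident)
  have N_sym: "N u \<bullet> u' = u \<bullet> N u'" for u u'
    by (simp add: N_def inner_diff_left inner_diff_right sym)
  have N_pos: "0 \<le> N u \<bullet> u" if "u \<in> W" for u
  proof (cases "u = 0")
    case False
    have "(1 / norm u) *\<^sub>R u \<in> K"
      using that W False by (simp add: K_def subspace_scale)
    then have "T ((1 / norm u) *\<^sub>R u) \<bullet> ((1 / norm u) *\<^sub>R u) \<le> l"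
      using max l_def by blast
    then have "(T u \<bullet> u) / (norm u)^2 \<le> l"
      using T by (simp add: linear_scale power2_eq_square)
    then have "T u \<bullet> u \<le> l * (u \<bullet> u)"
      using False by (simp add: field_simps power2_norm_eq_inner)
    then show ?thesis
      by (simp add: N_def inner_diff_left)
  qed simp
  have "N v \<bullet> v = 0"
    by (simp add: N_def inner_diff_left vv l_def)
  define w where "w = N v"
  define c where "c = N w \<bullet> w"
  have wW: "w \<in> W"
    unfolding w_def N_def using W vW inv by (intro subspace_diff subspace_scale) auto
  define s where "s = - 1 / (c + 1)"
  define a where "a = w \<bullet> w"
  have c: "0 \<le> c"
    unfolding c_def using N_pos wW by blast
  have "s * (c + 1) = - 1"
    using c by (simp add: s_def)
  \<comment> \<open>The form of \<open>N\<close> is nonnegative and vanishes at \<open>v\<close>; moving from \<open>v\<close> in the direction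
    \<open>- N v\<close> would make it negative.\<close>
  have "0 \<le> N (v + (s * a) *\<^sub>R w) \<bullet> (v + (s * a) *\<^sub>R w)"
    using W vW wW by (intro N_pos subspace_add subspace_scale) auto
  also have "\<dots> = 2 * (s * a) * a + (s * a)^2 * c"
    using \<open>N v \<bullet> v = 0\<close> N N_sym[of w v]
    by (simp add: linear_add linear_scale inner_add_left inner_add_right c_def a_def
        power2_eq_square inner_commute flip: w_def)
  also have "\<dots> = - (a^2 * (c + 2) * s^2)"
    using \<open>s * (c + 1) = - 1\<close> by algebra
  finally have "a = 0"
    using c \<open>s * (c + 1) = - 1\<close> by (auto simp: mult_le_0_iff)
  then have "T v = l *\<^sub>R v"
    by (simp add: a_def w_def N_def)
  moreover have "v \<noteq> 0"
    using vv by auto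
  ultimately show ?thesis
    using vW by blast
qed

text \<open>
  On an invariant subspace of minimal positive dimension every operator of the family is a scalar.
  Working over the reals suffices for complex self-adjoint matrices, since their eigenvalues are
  real and they are symmetric for the real part of the Hermitian product.
\<close>

lemma commuting_symmetric_operators_have_common_eigenvector:
  fixes T :: "'i \<Rightarrow> 'a::euclidean_space \<Rightarrow> 'a"
  assumes T: "\<And>r. linear (T r)" and sym: "\<And>r v w. T r v \<bullet> w = v \<bullet> T r w"
    and comm: "\<And>r q v. T r (T q v) = T q (T r v)"
    and W: "subspace W" "W \<noteq> {0}" and inv: "\<And>r v. v \<in> W \<Longrightarrow> T r v \<in> W"
  shows "\<exists>v\<in>W. norm v = 1 \<and> (\<exists>l. \<forall>r. T r v = l r *\<^sub>R v)"
proof -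
  define P where "P L \<longleftrightarrow> subspace L \<and> L \<noteq> {0} \<and> L \<subseteq> W \<and> (\<forall>r. \<forall>v\<in>L. T r v \<in> L)" for L
  have "P W"
    using W inv by (simp add: P_def)
  then obtain L where L: "P L" and min: "\<And>L'. P L' \<Longrightarrow> dim L \<le> dim L'"
    using ex_has_least_nat[of P W dim] by blast
  \<comment> \<open>An eigenspace of one operator inside \<open>L\<close> is invariant under all of them, hence is \<open>L\<close>.\<close>
  have "\<exists>l. \<forall>v\<in>L. T r v = l *\<^sub>R v" for r
  proof -
    obtain v l where v: "v \<in> L" "v \<noteq> 0" "T r v = l *\<^sub>R v"
      using symmetric_operator_has_eigenvector[of "T r" L] T sym L unfolding P_def by metis
    define E where "E = {u \<in> L. T r u = l *\<^sub>R u}"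
    have "subspace E"
      using L T by (auto simp: E_def P_def subspace_def linear_add linear_scale linear_0
          scaleR_add_right)
    moreover have "T q u \<in> E" if "u \<in> E" for q u
      using that L T comm[of r q u] by (auto simp: E_def P_def linear_scale)
    ultimately have "P E"
      using v L unfolding P_def by (auto simp: E_def)
    then have "E = L"
      using min[of E] L by (intro subspace_dim_equal) (auto simp: P_def E_def)
    then show ?thesis
      by (auto simp: E_def)
  qed
  then obtain l where l: "\<And>r v. v \<in> L \<Longrightarrow> T r v = l r *\<^sub>R v"
    by metis
  obtain u where u: "u \<in> L" "u \<noteq> 0"
    using L subspace_0[of L] unfolding P_def by blast
  define v where "v = (1 / norm u) *\<^sub>R u"
  have "v \<in> L" "norm v = 1"
    using u L by (auto simp: v_def P_def subspace_scale)
  then show ?thesis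
    using l L unfolding P_def by blast
qed

definition herm :: "complex^'n \<Rightarrow> complex^'n \<Rightarrow> complex" where
  "herm v w = (\<Sum>k\<in>UNIV. cnj (v $ k) * w $ k)"

lemma Re_herm: "Re (herm v w) = v \<bullet> w"
  by (simp add: herm_def inner_vec_def inner_complex_def)

lemma herm_self: "herm v v = complex_of_real ((norm v)^2)"
proof (rule complex_eqI)
  show "Re (herm v v) = Re (complex_of_real ((norm v)^2))"
    by (simp add: Re_herm power2_norm_eq_inner)
  show "Im (herm v v) = Im (complex_of_real ((norm v)^2))"
    by (simp add: herm_def)
qed

lemma cnj_herm: "cnj (herm v w) = herm w v"
  by (simp add: herm_def mult.commute)

lemma herm_self_adjoint:
  assumes "self_adjoint A"
  shows "herm (A *v v) w = herm v (A *v w)"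
proof -
  have A: "cnj (A $ i $ j) = A $ j $ i" for i j
    using assms by (simp add: self_adjoint_def adj_def vec_eq_iff)
  have "herm (A *v v) w = (\<Sum>k\<in>UNIV. \<Sum>j\<in>UNIV. A $ j $ k * cnj (v $ j) * w $ k)"
    by (simp add: herm_def matrix_vector_mult_def sum_distrib_right A)
  also have "\<dots> = (\<Sum>j\<in>UNIV. \<Sum>k\<in>UNIV. A $ j $ k * cnj (v $ j) * w $ k)"
    by (rule sum.swap)
  also have "\<dots> = herm v (A *v w)"
    by (simp add: herm_def matrix_vector_mult_def sum_distrib_left mult_ac)
  finally show ?thesis .
qed

text \<open>
  The square matrix with rows \<open>cnj (v i)\<close> for \<open>i \<in> A\<close> and zero rows elsewhere has a zero row,
  hence determinant zero and a nontrivial kernel.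
\<close>

lemma exists_nonzero_orthogonal_vector:
  fixes v :: "'n::finite \<Rightarrow> complex^'n"
  assumes "b \<notin> A"
  shows "\<exists>w. w \<noteq> 0 \<and> (\<forall>i\<in>A. herm (v i) w = 0)"
proof -
  define B :: "complex^'n^'n" where "B = (\<chi> i k. if i \<in> A then cnj (v i $ k) else 0)"
  have "row b B = 0"
    using assms by (simp add: row_def B_def vec_eq_iff)
  then have "det B = 0"
    by (rule det_zero_row)
  then have "\<nexists>B'. B' ** B = mat 1"
    by (simp add: flip: invertible_left_inverse add: invertible_det_nz)
  then obtain w where w: "B *v w = 0" "w \<noteq> 0"
    using matrix_left_invertible_ker[of B] by blast
  have "herm (v i) w = 0" if "i \<in> A" for i
  proof -
    have "herm (v i) w = (B *v w) $ i"
      using that by (simp add: herm_def B_def matrix_vector_mult_def)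
    then show ?thesis
      using w by simp
  qed
  then show ?thesis
    using w by blast
qed

text \<open>
  The simultaneous spectral theorem.  The columns of the unitary matrix are chosen one after
  another: the orthogonal complement of joint eigenvectors is invariant under all components, so
  it contains a further joint eigenvector as long as some column is missing.
\<close>

lemma CS_joint_diagonalization_exists:
  fixes S :: "(complex^'n::finite^'n)^'d::finite"
  assumes "S \<in> CS"
  shows "\<exists>V y. joint_diagonalization S V y"
proof -
  have sa: "self_adjoint (S $ r)" and comm: "S $ r ** S $ q = S $ q ** S $ r" for r q
    using assms by (auto simp: CS_def)
  have "\<exists>(v :: 'n \<Rightarrow> complex^'n) y :: 'n \<Rightarrow> real^'d.
      (\<forall>i\<in>A. \<forall>j\<in>A. herm (v i) (v j) = (if i = j then 1 else 0)) \<and>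
      (\<forall>i\<in>A. \<forall>r. S $ r *v v i = (y i $ r) *\<^sub>R v i)" for A :: "'n set"
  proof (induction A rule: finite_induct[OF finite])
    case (2 b A)
    then obtain v :: "'n \<Rightarrow> complex^'n" and y :: "'n \<Rightarrow> real^'d"
      where orth: "\<And>i j. i \<in> A \<Longrightarrow> j \<in> A \<Longrightarrow> herm (v i) (v j) = (if i = j then 1 else 0)"
        and eig: "\<And>i r. i \<in> A \<Longrightarrow> S $ r *v v i = (y i $ r) *\<^sub>R v i"
      by blast
    define W where "W = {w. \<forall>i\<in>A. herm (v i) w = 0}"
    have "subspace W"
      by (auto simp: W_def subspace_def herm_def algebra_simps sum.distrib
          simp flip: scaleR_sum_right)
    moreover have "W \<noteq> {0}"
      using exists_nonzero_orthogonal_vector[OF \<open>b \<notin> A\<close>, of v] by (auto simp: W_def)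
    moreover have "S $ r *v w \<in> W" if "w \<in> W" for r w
    proof -
      have "herm (v i) (S $ r *v w) = 0" if "i \<in> A" for i
      proof -
        have "herm (v i) (S $ r *v w) = herm ((y i $ r) *\<^sub>R v i) w"
          using eig that by (simp flip: herm_self_adjoint[OF sa])
        also have "\<dots> = (y i $ r) *\<^sub>R herm (v i) w"
          by (simp add: herm_def scaleR_sum_right)
        finally show ?thesis
          using \<open>w \<in> W\<close> that by (simp add: W_def)
      qed
      then show ?thesis
        by (simp add: W_def)
    qed
    moreover have "S $ r *v (S $ q *v w) = S $ q *v (S $ r *v w)" for r q w
      by (simp add: matrix_vector_mul_assoc comm[of r q])
    moreover have "(S $ r *v u) \<bullet> w = u \<bullet> (S $ r *v w)" for r u w
      by (metis Re_herm herm_self_adjoint sa)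
    moreover have "linear ((*v) (S $ r))" for r
      by (simp add: linear_linear[symmetric])
    ultimately obtain w l where w: "w \<in> W" "norm w = 1" "\<And>r. S $ r *v w = l r *\<^sub>R w"
      using commuting_symmetric_operators_have_common_eigenvector[of "\<lambda>r. (*v) (S $ r)" W]
      by blast
    have "herm (v i) w = 0" "herm w (v i) = 0" if "i \<in> A" for i
      using w that cnj_herm[of "v i" w] by (auto simp: W_def)
    moreover have "herm w w = 1"
      using w by (simp add: herm_self)
    ultimately show ?case
      using orth eig w \<open>b \<notin> A\<close>
      by (intro exI[of _ "v(b := w)"] exI[of _ "y(b := (\<chi> r. l r))"]) auto
  qed simp
  from this[of UNIV] obtain v :: "'n \<Rightarrow> complex^'n" and y :: "'n \<Rightarrow> real^'d"
    where orth: "\<And>i j. herm (v i) (v j) = (if i = j then 1 else 0)"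
      and eig: "\<And>i r. S $ r *v v i = (y i $ r) *\<^sub>R v i"
    by auto
  define V :: "complex^'n^'n" where "V = (\<chi> k i. v i $ k)"
  have "adj V ** V = mat 1"
    using orth by (simp add: vec_eq_iff adj_def V_def matrix_matrix_mult_def mat_def herm_def)
  moreover from this have VV: "V ** adj V = mat 1"
    using matrix_left_right_inverse by blast
  moreover have "S $ r = V ** diag (\<lambda>i. y i $ r) ** adj V" for r
  proof -
    have "(S $ r ** V) $ k $ i = (V ** diag (\<lambda>i. y i $ r)) $ k $ i" for k i
    proof -
      have "(S $ r ** V) $ k $ i = (S $ r *v v i) $ k"
        by (simp add: matrix_matrix_mult_def matrix_vector_mult_def V_def)
      then show ?thesis
        by (simp add: eig matrix_mult_diag_right V_def) (simp add: scaleR_conv_of_real)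
    qed
    then have "S $ r ** V = V ** diag (\<lambda>i. y i $ r)"
      by (simp add: vec_eq_iff)
    then show ?thesis
      by (metis VV matrix_mul_assoc matrix_mul_rid)
  qed
  ultimately show ?thesis
    by (auto simp: joint_diagonalization_def unitary_def)
qed

section \<open>Spectral perturbation of a diagonal tuple\<close>

lemma unitary_row_products:
  assumes "unitary W"
  shows "(\<Sum>j\<in>UNIV. W $ a $ j * cnj (W $ b $ j)) = (if a = b then 1 else 0)"
proof -
  have "(W ** adj W) $ a $ b = mat 1 $ a $ b"
    using assms by (simp add: unitary_def)
  then show ?thesis
    by (simp add: matrix_matrix_mult_def adj_def mat_def)
qed

lemma unitary_column_norm:
  fixes W :: "complex^'n::finite^'n"
  assumes "unitary W"
  shows "(\<Sum>k\<in>UNIV. (cmod (W $ k $ j))\<^sup>2) = 1"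
proof -
  have "(adj W ** W) $ j $ j = mat 1 $ j $ j"
    using assms by (simp add: unitary_def)
  then have "(\<Sum>k\<in>UNIV. W $ k $ j * cnj (W $ k $ j)) = 1"
    by (simp add: matrix_matrix_mult_def adj_def mat_def mult.commute)
  then have "complex_of_real (\<Sum>k\<in>UNIV. (cmod (W $ k $ j))\<^sup>2) = complex_of_real 1"
    by (simp flip: complex_norm_square)
  then show ?thesis
    using of_real_eq_iff by blast
qed

lemma unitary_entry_le_1:
  fixes W :: "complex^'n::finite^'n"
  assumes "unitary W"
  shows "cmod (W $ a $ j) \<le> 1"
proof -
  have "(cmod (W $ a $ j))\<^sup>2 \<le> (\<Sum>k\<in>UNIV. (cmod (W $ k $ j))\<^sup>2)"
    by (rule member_le_sum) auto
  then show ?thesis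
    by (simp add: unitary_column_norm[OF assms] power_le_one_iff)
qed

lemma unitary_column_sum_ge_1:
  fixes W :: "complex^'n::finite^'n"
  assumes "unitary W"
  shows "1 \<le> (\<Sum>k\<in>UNIV. cmod (W $ k $ j))"
proof -
  have "(\<Sum>k\<in>UNIV. (cmod (W $ k $ j))\<^sup>2) \<le> (\<Sum>k\<in>UNIV. cmod (W $ k $ j))"
    using unitary_entry_le_1[OF assms] by (intro sum_mono) (simp add: power2_eq_square mult_left_le)
  then show ?thesis
    by (simp add: unitary_column_norm[OF assms])
qed

text \<open>
  Row orthonormality of \<open>W\<close> lets \<open>diag h\<close> be written with the same weights as the conjugated
  matrix, so that only differences \<open>g j - h a\<close> appear.
\<close>

lemma conjugated_diag_minus_diag_entry:
  assumes "unitary W"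
  shows "(W ** diag g ** adj W - diag h) $ a $ b
    = (\<Sum>j\<in>UNIV. W $ a $ j * cnj (W $ b $ j) * complex_of_real (g j - h a))"
proof -
  have "(W ** diag g ** adj W) $ a $ b
      = (\<Sum>j\<in>UNIV. W $ a $ j * cnj (W $ b $ j) * complex_of_real (g j))"
    by (simp add: matrix_matrix_mult_def[of "W ** diag g"] matrix_mult_diag_right adj_def mult_ac)
  moreover have "diag h $ a $ b
      = (\<Sum>j\<in>UNIV. W $ a $ j * cnj (W $ b $ j) * complex_of_real (h a))"
    by (simp add: unitary_row_products[OF assms] diag_def flip: sum_distrib_right)
  ultimately show ?thesis
    by (simp add: sum_subtractf right_diff_distrib)
qed

lemma tuple_entry_le_norm: "cmod (H $ r $ a $ b) \<le> norm (H :: (complex^'n::finite^'m::finite)^'d::finite)"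
  by (meson Finite_Cartesian_Product.norm_nth_le order_trans)

text \<open>
  The product \<open>W $ a $ j * (y j - x a) $ r\<close> is the \<open>(a, j)\<close> entry of \<open>(T - D) $ r ** W\<close>, because
  \<open>T $ r ** W = W ** diag (\<lambda>i. y i $ r)\<close> and \<open>D $ r\<close> is diagonal.
\<close>

lemma eigenvalue_displacement_le:
  fixes T D :: "(complex^'n::finite^'n)^'d::finite"
  assumes T: "joint_diagonalization T W y" and D: "\<And>r. D $ r = diag (\<lambda>i. x i $ r)"
  shows "cmod (W $ a $ j) * norm (y j - x a) \<le> real CARD('n) * real CARD('d) * norm (T - D)"
proof -
  have W: "unitary W"
    using T by (simp add: joint_diagonalization_def)
  have "cmod (W $ a $ j) * \<bar>(y j - x a) $ r\<bar> \<le> real CARD('n) * norm (T - D)" for r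
  proof -
    have "T $ r ** W = W ** diag (\<lambda>i. y i $ r) ** (adj W ** W)"
      using T by (simp add: joint_diagonalization_def matrix_mul_assoc)
    then have "T $ r ** W = W ** diag (\<lambda>i. y i $ r)"
      using W by (simp add: unitary_def)
    then have "((T $ r ** W) - (D $ r ** W)) $ a $ j
        = W $ a $ j * complex_of_real ((y j - x a) $ r)"
      by (simp add: D matrix_mult_diag_left matrix_mult_diag_right algebra_simps)
    moreover have "((T $ r ** W) - (D $ r ** W)) $ a $ j
        = (\<Sum>b\<in>UNIV. (T - D) $ r $ a $ b * W $ b $ j)"
      by (simp add: matrix_matrix_mult_def left_diff_distrib sum_subtractf)
    ultimately have "cmod (W $ a $ j) * \<bar>(y j - x a) $ r\<bar>
        = cmod (\<Sum>b\<in>UNIV. (T - D) $ r $ a $ b * W $ b $ j)"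
      by (metis norm_mult norm_of_real)
    also have "\<dots> \<le> (\<Sum>b\<in>(UNIV :: 'n set). norm (T - D) * 1)"
      unfolding norm_mult[symmetric]
      by (intro sum_norm_le order_trans[OF norm_mult_ineq] mult_mono tuple_entry_le_norm
          unitary_entry_le_1 W) auto
    finally show ?thesis
      by simp
  qed
  then have "(\<Sum>r\<in>UNIV. cmod (W $ a $ j) * \<bar>(y j - x a) $ r\<bar>)
      \<le> (\<Sum>r\<in>(UNIV :: 'd set). real CARD('n) * norm (T - D))"
    by (intro sum_mono)
  moreover have "cmod (W $ a $ j) * norm (y j - x a)
      \<le> cmod (W $ a $ j) * (\<Sum>r\<in>UNIV. \<bar>(y j - x a) $ r\<bar>)"
    by (intro mult_left_mono norm_le_l1_cart) simp
  ultimately show ?thesis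
    by (simp add: sum_distrib_left mult_ac)
qed

text \<open>
  The moduli of the entries of the \<open>j\<close>-th column of \<open>W\<close> sum to at least one, so the sum of the
  displacement bounds over this column bounds the smallest of the distances.
\<close>

lemma perturbed_eigenvalue_near:
  fixes T D :: "(complex^'n::finite^'n)^'d::finite"
  assumes T: "joint_diagonalization T W y" and D: "\<And>r. D $ r = diag (\<lambda>i. x i $ r)"
  shows "\<exists>k. norm (y j - x k) \<le> real CARD('n) * (real CARD('n) * real CARD('d) * norm (T - D))"
proof -
  have W: "unitary W"
    using T by (simp add: joint_diagonalization_def)
  define \<mu> where "\<mu> = Min (range (\<lambda>i. norm (y j - x i)))"
  have "\<mu> \<in> range (\<lambda>i. norm (y j - x i))"
    unfolding \<mu>_def by (rule Min_in) auto
  then obtain k where "norm (y j - x k) = \<mu>"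
    by auto
  then have k: "norm (y j - x k) \<le> norm (y j - x i)" for i
    by (simp add: \<mu>_def)
  have "norm (y j - x k) \<le> (\<Sum>i\<in>UNIV. cmod (W $ i $ j)) * norm (y j - x k)"
    using mult_right_mono[OF unitary_column_sum_ge_1[OF W, of j] norm_ge_zero[of "y j - x k"]]
    by simp
  also have "\<dots> \<le> (\<Sum>i\<in>UNIV. cmod (W $ i $ j) * norm (y j - x i))"
    unfolding sum_distrib_right by (intro sum_mono mult_left_mono k) simp
  also have "\<dots> \<le> (\<Sum>i\<in>(UNIV :: 'n set). real CARD('n) * real CARD('d) * norm (T - D))"
    by (intro sum_mono eigenvalue_displacement_le[OF T D])
  finally show ?thesis
    by (intro exI[of _ k]) simp
qed

text \<open>
  A function that is \<open>o(norm (z - x0) ^ m)\<close> at \<open>x0\<close> and bounded near the points \<open>x k\<close> satisfies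
  one estimate near all of them at once: away from \<open>x0\<close> the term of order \<open>m + 1\<close> dominates the
  bound of the function.
\<close>

lemma vanishing_order_bound_near_points:
  fixes R :: "'a::real_normed_vector \<Rightarrow> real" and x :: "'n::finite \<Rightarrow> 'a"
  assumes cont: "\<And>k. isCont R (x k)"
    and order: "\<And>\<epsilon>. 0 < \<epsilon> \<Longrightarrow>
      \<exists>\<delta>>0. \<forall>z. norm (z - x0) < \<delta> \<longrightarrow> \<bar>R z\<bar> \<le> \<epsilon> * norm (z - x0) ^ m"
    and "0 < \<epsilon>"
  shows "\<exists>\<rho>>0. \<exists>K\<ge>0. \<forall>z k. norm (z - x k) < \<rho> \<longrightarrow>
    \<bar>R z\<bar> \<le> \<epsilon> * norm (z - x0) ^ m + K * norm (z - x0) ^ Suc m"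
proof -
  obtain \<delta> where \<delta>: "0 < \<delta>" "\<And>z. norm (z - x0) < \<delta> \<Longrightarrow> \<bar>R z\<bar> \<le> \<epsilon> * norm (z - x0) ^ m"
    using order \<open>0 < \<epsilon>\<close> by blast
  have "\<exists>\<rho>>0. \<forall>z. norm (z - x k) < \<rho> \<longrightarrow> \<bar>R z - R (x k)\<bar> < 1" for k
    using cont[of k] unfolding continuous_at_eps_delta dist_norm by (metis real_norm_def zero_less_one)
  then obtain \<rho> where \<rho>: "\<And>k. 0 < \<rho> k"
      "\<And>k z. norm (z - x k) < \<rho> k \<Longrightarrow> \<bar>R z - R (x k)\<bar> < 1"
    by metis
  define M where "M = (\<Sum>k\<in>UNIV. \<bar>R (x k)\<bar>) + 1"
  have M: "\<bar>R z\<bar> \<le> M" if "norm (z - x k) < \<rho> k" for k z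
  proof -
    have "\<bar>R (x k)\<bar> \<le> (\<Sum>k\<in>UNIV. \<bar>R (x k)\<bar>)"
      by (rule member_le_sum) auto
    then show ?thesis
      using \<rho>(2)[OF that] by (simp add: M_def)
  qed
  have "0 \<le> M"
    by (simp add: M_def sum_nonneg)
  have bound: "\<bar>R z\<bar> \<le> \<epsilon> * norm (z - x0) ^ m + M / \<delta> ^ Suc m * norm (z - x0) ^ Suc m"
    if "norm (z - x k) < \<rho> k" for z k
  proof (cases "norm (z - x0) < \<delta>")
    case True
    have "0 \<le> M / \<delta> ^ Suc m * norm (z - x0) ^ Suc m"
      using \<open>0 \<le> M\<close> \<delta> by (intro mult_nonneg_nonneg divide_nonneg_nonneg zero_le_power) auto
    then show ?thesis
      using \<delta>(2)[OF True] by linarith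
  next
    case False
    have "M = M / \<delta> ^ Suc m * \<delta> ^ Suc m"
      using \<delta> by simp
    also have "\<dots> \<le> M / \<delta> ^ Suc m * norm (z - x0) ^ Suc m"
      using False \<open>0 \<le> M\<close> \<delta>
      by (intro mult_left_mono power_mono divide_nonneg_nonneg zero_le_power) auto
    moreover have "0 \<le> \<epsilon> * norm (z - x0) ^ m"
      using \<open>0 < \<epsilon>\<close> by simp
    ultimately show ?thesis
      using M[OF that] by linarith
  qed
  show ?thesis
  proof (intro exI conjI allI impI)
    show "0 < Min (range \<rho>)" "0 \<le> M / \<delta> ^ Suc m"
      using \<rho> \<open>0 \<le> M\<close> \<delta> by simp_all
    show "\<bar>R z\<bar> \<le> \<epsilon> * norm (z - x0) ^ m + M / \<delta> ^ Suc m * norm (z - x0) ^ Suc m"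
      if "norm (z - x k) < Min (range \<rho>)" for z k
      using that by (intro bound[of _ k]) simp
  qed
qed

text \<open>
  This turns the vanishing order of \<open>R\<close> at \<open>x a\<close> into smallness in \<open>T - D\<close>.  By the previous
  bound a summand is controlled by \<open>u * v * s ^ m\<close> and \<open>u * v * s ^ Suc m\<close>, where \<open>u\<close> and \<open>v\<close> are
  the moduli of the weights and \<open>s = norm (y j - x a)\<close>.  Each factor \<open>s\<close> is absorbed by one weight
  through the displacement bound.  For \<open>m = 1\<close> the factor \<open>s ^ 2\<close> needs both weights, and \<open>v\<close>
  absorbs \<open>s\<close> only if \<open>x a = x b\<close>.
\<close>

lemma spectral_sum_small:
  fixes D :: "(complex^'n::finite^'n)^'d::finite" and R :: "real^'d \<Rightarrow> real"
  assumes D: "\<And>r. D $ r = diag (\<lambda>i. x i $ r)"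
    and cont: "\<And>k. isCont R (x k)"
    and order: "\<And>\<epsilon>. 0 < \<epsilon> \<Longrightarrow>
      \<exists>\<delta>>0. \<forall>z. norm (z - x a) < \<delta> \<longrightarrow> \<bar>R z\<bar> \<le> \<epsilon> * norm (z - x a) ^ m"
    and m: "m = 0 \<or> m = 1 \<and> x a = x b"
    and "0 < \<epsilon>"
  shows "\<forall>\<^sub>F T in at D within A. \<forall>W y. joint_diagonalization T W y \<longrightarrow>
    cmod (\<Sum>j\<in>UNIV. W $ a $ j * cnj (W $ b $ j) * complex_of_real (R (y j)))
      \<le> \<epsilon> * norm (T - D) ^ m"
proof -
  define n where "n = real CARD('n)"
  define c where "c = n * real CARD('d)"
  have n: "0 < n" and c: "0 < c"
    by (simp_all add: n_def c_def)
  \<comment> \<open>There are \<open>n\<close> summands, each at most \<open>\<epsilon>' * (c * e) ^ m + K * (c * e) ^ Suc m\<close> for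
    \<open>e = norm (T - D)\<close>; the two parts get half of \<open>\<epsilon>\<close> each.\<close>
  define \<epsilon>' where "\<epsilon>' = \<epsilon> / (2 * n * c ^ m)"
  have "0 < \<epsilon>'"
    using \<open>0 < \<epsilon>\<close> n c by (simp add: \<epsilon>'_def)
  with cont order have "\<exists>\<rho>>0. \<exists>K\<ge>0. \<forall>z k. norm (z - x k) < \<rho> \<longrightarrow>
      \<bar>R z\<bar> \<le> \<epsilon>' * norm (z - x a) ^ m + K * norm (z - x a) ^ Suc m"
    by (rule vanishing_order_bound_near_points)
  then obtain \<rho> K where \<rho>: "0 < \<rho>" and K: "0 \<le> K" and R: "\<And>z k. norm (z - x k) < \<rho> \<Longrightarrow>
      \<bar>R z\<bar> \<le> \<epsilon>' * norm (z - x a) ^ m + K * norm (z - x a) ^ Suc m"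
    by blast
  define Q where "Q = 2 * n * (K + 1) * c ^ Suc m"
  have "0 < Q"
    using n c K by (simp add: Q_def)
  define \<delta> where "\<delta> = min (\<rho> / (n * c)) (\<epsilon> / Q)"
  have "0 < \<delta>"
    using \<rho> n c \<open>0 < Q\<close> \<open>0 < \<epsilon>\<close> by (simp add: \<delta>_def)
  have "cmod (\<Sum>j\<in>UNIV. W $ a $ j * cnj (W $ b $ j) * complex_of_real (R (y j)))
      \<le> \<epsilon> * norm (T - D) ^ m"
    if T: "joint_diagonalization T W y" and small: "norm (T - D) < \<delta>" for T W y
  proof -
    have W: "unitary W"
      using T by (simp add: joint_diagonalization_def)
    define e where "e = norm (T - D)"
    have e: "0 \<le> e" "n * (c * e) < \<rho>" "e * Q \<le> \<epsilon>"
      using small n c \<open>0 < Q\<close> by (auto simp: e_def \<delta>_def field_simps)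
    have disp: "cmod (W $ i $ j) * norm (y j - x i) \<le> c * e" for i j
      using eigenvalue_displacement_le[OF T D, of i j] by (simp add: n_def c_def e_def)
    have summand: "cmod (W $ a $ j * cnj (W $ b $ j) * complex_of_real (R (y j)))
        \<le> \<epsilon>' * (c * e) ^ m + K * (c * e) ^ Suc m" for j
    proof -
      define u v s where "u = cmod (W $ a $ j)" and "v = cmod (W $ b $ j)"
        and "s = norm (y j - x a)"
      have uv: "0 \<le> u" "u \<le> 1" "0 \<le> v" "v \<le> 1" and s: "0 \<le> s" "u * s \<le> c * e"
        using unitary_entry_le_1[OF W] disp by (auto simp: u_def v_def s_def)
      have us: "u * v * s \<le> c * e"
        using mult_mono[OF s(2) uv(4)] s uv c e by (simp add: mult_ac)
      have vs: "v * s \<le> c * e" if "x a = x b"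
        using disp[of b j] that by (simp add: v_def s_def)
      have uv1: "u * v \<le> 1"
        using mult_mono[OF uv(2) uv(4)] uv by simp
      have "u * v * s ^ m \<le> (c * e) ^ m" "u * v * s ^ Suc m \<le> (c * e) ^ Suc m"
      proof -
        have "u * v * (s * s) \<le> (c * e) * (c * e)" if "x a = x b"
          using mult_mono[OF s(2) vs[OF that]] uv s(1) e c by (simp add: mult_ac)
        then show "u * v * s ^ m \<le> (c * e) ^ m" "u * v * s ^ Suc m \<le> (c * e) ^ Suc m"
          using m us uv1 by auto
      qed
      then have "\<epsilon>' * (u * v * s ^ m) + K * (u * v * s ^ Suc m)
          \<le> \<epsilon>' * (c * e) ^ m + K * (c * e) ^ Suc m"
        using \<open>0 < \<epsilon>'\<close> K by (intro add_mono mult_left_mono) auto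
      moreover obtain k where "norm (y j - x k) \<le> n * (c * e)"
        using perturbed_eigenvalue_near[OF T D, of j] by (auto simp: n_def c_def e_def)
      then have "\<bar>R (y j)\<bar> \<le> \<epsilon>' * s ^ m + K * s ^ Suc m"
        unfolding s_def using e by (intro R[of _ k]) simp
      then have "u * v * \<bar>R (y j)\<bar> \<le> u * v * (\<epsilon>' * s ^ m + K * s ^ Suc m)"
        using uv by (intro mult_left_mono) auto
      ultimately have "u * v * \<bar>R (y j)\<bar> \<le> \<epsilon>' * (c * e) ^ m + K * (c * e) ^ Suc m"
        by (simp add: algebra_simps)
      then show ?thesis
        by (simp add: norm_mult u_def v_def)
    qed
    have "n * K * c ^ Suc m * e \<le> n * (K + 1) * c ^ Suc m * e"
      using n c e by (intro mult_right_mono) auto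
    also have "\<dots> \<le> \<epsilon> / 2"
      using e(3) by (simp add: Q_def algebra_simps)
    finally have half: "n * K * c ^ Suc m * e \<le> \<epsilon> / 2" .
    have "cmod (\<Sum>j\<in>UNIV. W $ a $ j * cnj (W $ b $ j) * complex_of_real (R (y j)))
        \<le> (\<Sum>j\<in>(UNIV :: 'n set). \<epsilon>' * (c * e) ^ m + K * (c * e) ^ Suc m)"
      by (intro sum_norm_le summand)
    also have "\<dots> = (n * \<epsilon>' * c ^ m + n * K * c ^ Suc m * e) * e ^ m"
      by (simp add: n_def power_mult_distrib algebra_simps)
    also have "\<dots> = (\<epsilon> / 2 + n * K * c ^ Suc m * e) * e ^ m"
      using n c by (simp add: \<epsilon>'_def)
    also have "\<dots> \<le> (\<epsilon> / 2 + \<epsilon> / 2) * e ^ m"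
      using half e by (intro mult_right_mono add_left_mono) auto
    finally show ?thesis
      by (simp add: e_def)
  qed
  then show ?thesis
    using \<open>0 < \<delta>\<close> unfolding eventually_at dist_norm by blast
qed

section \<open>The matrix function near a diagonal tuple\<close>

lemma has_derivative_vec:
  fixes F :: "'a::real_normed_vector \<Rightarrow> 'b::euclidean_space^'n::finite"
  assumes "\<And>i. ((\<lambda>z. F z $ i) has_derivative (\<lambda>h. F' h $ i)) (at x within A)"
  shows "(F has_derivative F') (at x within A)"
proof (subst has_derivative_componentwise_within, rule ballI)
  fix b :: "'b^'n" assume "b \<in> Basis"
  then obtain i u where b: "b = axis i u"
    by (auto simp: Basis_vec_def)
  show "((\<lambda>z. F z \<bullet> b) has_derivative (\<lambda>h. F' h \<bullet> b)) (at x within A)"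
    unfolding b inner_axis by (rule has_derivative_inner_left[OF assms])
qed

lemma adj_mat_1: "adj (mat 1 :: complex^'n::finite^'n) = mat 1"
  by (simp add: adj_def mat_def vec_eq_iff)

lemma joint_diagonalization_diagonal:
  assumes "\<And>r. D $ r = diag (\<lambda>i. x i $ r)"
  shows "joint_diagonalization D (mat 1) x"
  using assms by (simp add: joint_diagonalization_def unitary_def adj_mat_1)

lemma matrix_function_diagonal:
  assumes "\<And>r. D $ r = diag (\<lambda>i. x i $ r)"
  shows "matrix_function f D = diag (\<lambda>i. f (x i))"
  by (simp add: matrix_function_eq[OF joint_diagonalization_diagonal[OF assms]] adj_mat_1)

lemma matrix_function_commutes:
  assumes "joint_diagonalization T W y"
  shows "matrix_function f T ** T $ r = T $ r ** matrix_function f T"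
proof -
  have "adj W ** W = mat 1"
    using assms by (simp add: joint_diagonalization_def unitary_def)
  then have *: "(W ** diag g ** adj W) ** (W ** diag h ** adj W) = W ** (diag g ** diag h) ** adj W"
    for g h
    by (metis matrix_mul_assoc matrix_mul_rid)
  have "diag g ** diag h = diag h ** diag g" for g h :: "'a \<Rightarrow> real"
    by (simp add: vec_eq_iff matrix_mult_diag_right) (simp add: diag_def)
  moreover have "T $ r = W ** diag (\<lambda>i. y i $ r) ** adj W"
    using assms by (simp add: joint_diagonalization_def)
  ultimately show ?thesis
    using * by (simp add: matrix_function_eq[OF assms])
qed

lemma matrix_add_rdistrib:
  "(A + B) ** C = A ** C + B ** (C :: 'a::semiring_1^'n::finite^'m::finite)"
  by (simp add: matrix_matrix_mult_def vec_eq_iff distrib_right sum.distrib)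

lemma matrix_mult_entry_le:
  fixes A B :: "complex^'n::finite^'n"
  assumes "\<And>i j. cmod (A $ i $ j) \<le> \<alpha>" "\<And>i j. cmod (B $ i $ j) \<le> \<beta>"
  shows "cmod ((A ** B) $ a $ b) \<le> real CARD('n) * (\<alpha> * \<beta>)"
proof -
  have "0 \<le> \<alpha>"
    using assms(1)[of a b] norm_ge_zero order_trans by blast
  then have "cmod ((A ** B) $ a $ b) \<le> (\<Sum>k\<in>(UNIV :: 'n set). \<alpha> * \<beta>)"
    unfolding matrix_matrix_mult_def
    by (simp del: sum_constant) (intro sum_norm_le order_trans[OF norm_mult_ineq] mult_mono assms, auto)
  then show ?thesis
    by simp
qed

text \<open>
  The case \<open>m = 0\<close> of \<open>spectral_sum_small\<close>, applied to \<open>f z - f (x a)\<close>.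
\<close>

lemma matrix_function_continuous_at_diagonal:
  fixes D :: "(complex^'n::finite^'n)^'d::finite"
  assumes D: "\<And>r. D $ r = diag (\<lambda>i. x i $ r)"
    and cont: "\<And>k. isCont f (x k)"
    and "0 < \<epsilon>"
  shows "\<forall>\<^sub>F T in at D within CS. \<forall>a b.
    cmod ((matrix_function f T - matrix_function f D) $ a $ b) \<le> \<epsilon>"
proof (intro eventually_all_finite)
  fix a b
  have "\<forall>\<^sub>F T in at D within CS. \<forall>W y. joint_diagonalization T W y \<longrightarrow>
    cmod (\<Sum>j\<in>UNIV. W $ a $ j * cnj (W $ b $ j) * complex_of_real (f (y j) - f (x a)))
      \<le> \<epsilon> * norm (T - D) ^ 0"
  proof (rule spectral_sum_small[OF D])
    show "isCont (\<lambda>z. f z - f (x a)) (x k)" for k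
      by (intro continuous_intros cont)
    show "\<exists>\<delta>>0. \<forall>z. norm (z - x a) < \<delta> \<longrightarrow> \<bar>f z - f (x a)\<bar> \<le> \<epsilon> * norm (z - x a) ^ 0"
      if "0 < \<epsilon>" for \<epsilon>
      using cont[of a] that unfolding continuous_at_eps_delta dist_norm real_norm_def
      by (metis less_imp_le mult.right_neutral power_0)
  qed (use \<open>0 < \<epsilon>\<close> in auto)
  moreover have "\<forall>\<^sub>F T in at D within CS. T \<in> CS"
    by (simp add: eventually_at_filter)
  ultimately show "\<forall>\<^sub>F T in at D within CS.
      cmod ((matrix_function f T - matrix_function f D) $ a $ b) \<le> \<epsilon>"
  proof eventually_elim
    case (elim T)
    then obtain W y where T: "joint_diagonalization T W y"
      using CS_joint_diagonalization_exists by blast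
    then have W: "unitary W"
      by (simp add: joint_diagonalization_def)
    show ?case
      using elim(1) T conjugated_diag_minus_diag_entry[OF W, of "\<lambda>j. f (y j)" "\<lambda>i. f (x i)" a b]
      by (simp add: matrix_function_eq[OF T] matrix_function_diagonal[OF D])
  qed
qed

text \<open>
  The case \<open>m = 1\<close> of \<open>spectral_sum_small\<close>, applied to the first-order Taylor remainder of \<open>f\<close> at
  \<open>x a = x b\<close>: the linear terms of the Taylor expansion sum to entries of \<open>T - D\<close> exactly.
\<close>

lemma matrix_function_block_entry_has_derivative:
  fixes D :: "(complex^'n::finite^'n)^'d::finite"
  assumes D: "\<And>r. D $ r = diag (\<lambda>i. x i $ r)"
    and f: "\<And>k. (f has_derivative (\<lambda>v. \<Sum>r\<in>UNIV. p r k * v $ r)) (at (x k))"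
    and ab: "x a = x b"
  shows "((\<lambda>T. matrix_function f T $ a $ b) has_derivative
    (\<lambda>H. \<Sum>r\<in>UNIV. H $ r $ a $ b * complex_of_real (p r b))) (at D within CS)"
  unfolding has_derivative_within_alt2
proof (intro conjI allI impI)
  show "bounded_linear (\<lambda>H :: (complex^'n::finite^'n)^'d. \<Sum>r\<in>UNIV. H $ r $ a $ b * complex_of_real (p r b))"
    by (intro bounded_linear_sum bounded_linear_mult_const
        bounded_linear_compose[OF bounded_linear_vec_nth] bounded_linear_vec_nth)
  fix \<epsilon> :: real assume "0 < \<epsilon>"
  define R where "R z = f z - f (x b) - (\<Sum>r\<in>UNIV. p r b * (z - x b) $ r)" for z
  have "\<forall>\<^sub>F T in at D within CS. \<forall>W y. joint_diagonalization T W y \<longrightarrow>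
    cmod (\<Sum>j\<in>UNIV. W $ a $ j * cnj (W $ b $ j) * complex_of_real (R (y j)))
      \<le> \<epsilon> * norm (T - D) ^ 1"
  proof (rule spectral_sum_small[OF D])
    show "isCont R (x k)" for k
      unfolding R_def by (intro continuous_intros has_derivative_continuous[OF f])
    show "\<exists>\<delta>>0. \<forall>z. norm (z - x a) < \<delta> \<longrightarrow> \<bar>R z\<bar> \<le> \<epsilon> * norm (z - x a) ^ 1" if "0 < \<epsilon>" for \<epsilon>
      using f[of b] that unfolding has_derivative_within_alt R_def ab by simp
  qed (use \<open>0 < \<epsilon>\<close> ab in auto)
  moreover have "\<forall>\<^sub>F T in at D within CS. T \<in> CS"
    by (simp add: eventually_at_filter)
  ultimately show "\<forall>\<^sub>F T in at D within CS. norm (matrix_function f T $ a $ b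
      - matrix_function f D $ a $ b
      - (\<Sum>r\<in>UNIV. (T - D) $ r $ a $ b * complex_of_real (p r b))) \<le> \<epsilon> * norm (T - D)"
  proof eventually_elim
    case (elim T)
    then obtain W y where T: "joint_diagonalization T W y"
      using CS_joint_diagonalization_exists by blast
    then have W: "unitary W"
      by (simp add: joint_diagonalization_def)
    define \<omega> where "\<omega> j = W $ a $ j * cnj (W $ b $ j)" for j
    have F: "matrix_function f T $ a $ b - matrix_function f D $ a $ b
        = (\<Sum>j\<in>UNIV. \<omega> j * complex_of_real (f (y j) - f (x b)))"
      using conjugated_diag_minus_diag_entry[OF W, of "\<lambda>j. f (y j)" "\<lambda>i. f (x i)" a b]
      by (simp add: matrix_function_eq[OF T] matrix_function_diagonal[OF D] ab \<omega>_def)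
    have "T $ r = W ** diag (\<lambda>i. y i $ r) ** adj W" for r
      using T by (simp add: joint_diagonalization_def)
    then have "(T - D) $ r $ a $ b = (\<Sum>j\<in>UNIV. \<omega> j * complex_of_real ((y j - x b) $ r))" for r
      using conjugated_diag_minus_diag_entry[OF W, of "\<lambda>j. y j $ r" "\<lambda>i. x i $ r" a b]
      by (simp add: D ab \<omega>_def)
    then have "(\<Sum>r\<in>UNIV. (T - D) $ r $ a $ b * complex_of_real (p r b))
        = (\<Sum>r\<in>UNIV. \<Sum>j\<in>UNIV. \<omega> j * complex_of_real (p r b * (y j - x b) $ r))"
      by (simp add: sum_distrib_left mult_ac)
    also have "\<dots> = (\<Sum>j\<in>UNIV. \<Sum>r\<in>UNIV. \<omega> j * complex_of_real (p r b * (y j - x b) $ r))"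
      by (rule sum.swap)
    also have "\<dots> = (\<Sum>j\<in>UNIV. \<omega> j * complex_of_real (\<Sum>r\<in>UNIV. p r b * (y j - x b) $ r))"
      by (simp add: sum_distrib_left)
    finally have "matrix_function f T $ a $ b - matrix_function f D $ a $ b
        - (\<Sum>r\<in>UNIV. (T - D) $ r $ a $ b * complex_of_real (p r b))
        = (\<Sum>j\<in>UNIV. \<omega> j * complex_of_real (R (y j)))"
      unfolding F R_def of_real_diff right_diff_distrib sum_subtractf by simp
    then show ?case
      using elim(1) T by (simp add: \<omega>_def)
  qed
qed

text \<open>
  The increment \<open>G\<close> of the matrix function satisfies a linear equation, obtained from the fact that
  the matrix function of \<open>T\<close> commutes with \<open>T $ q\<close>.  It can be solved for \<open>G $ a $ b\<close> because
  \<open>x b $ q \<noteq> x a $ q\<close>, up to the products \<open>H ** G\<close> and \<open>G ** H\<close> with \<open>H = (T - D) $ q\<close>, and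
  continuity makes these negligible compared with \<open>T - D\<close>.
\<close>

lemma matrix_function_offblock_entry_has_derivative:
  fixes D :: "(complex^'n::finite^'n)^'d::finite"
  assumes D: "\<And>r. D $ r = diag (\<lambda>i. x i $ r)"
    and cont: "\<And>k. isCont f (x k)"
    and ab: "x b $ q - x a $ q \<noteq> 0"
  shows "((\<lambda>T. matrix_function f T $ a $ b) has_derivative
    (\<lambda>H. H $ q $ a $ b * complex_of_real ((f (x b) - f (x a)) / (x b $ q - x a $ q))))
    (at D within CS)"
  unfolding has_derivative_within_alt2
proof (intro conjI allI impI)
  define gap where "gap = x b $ q - x a $ q"
  show "bounded_linear (\<lambda>H :: (complex^'n::finite^'n)^'d.
      H $ q $ a $ b * complex_of_real ((f (x b) - f (x a)) / (x b $ q - x a $ q)))"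
    by (intro bounded_linear_mult_const
        bounded_linear_compose[OF bounded_linear_vec_nth] bounded_linear_vec_nth)
  fix \<epsilon> :: real assume "0 < \<epsilon>"
  define \<eta> where "\<eta> = \<epsilon> * \<bar>gap\<bar> / (2 * real CARD('n))"
  have "0 < \<eta>"
    using \<open>0 < \<epsilon>\<close> ab by (simp add: \<eta>_def gap_def)
  with D cont have "\<forall>\<^sub>F T in at D within CS. \<forall>a b.
      cmod ((matrix_function f T - matrix_function f D) $ a $ b) \<le> \<eta>"
    by (rule matrix_function_continuous_at_diagonal)
  moreover have "\<forall>\<^sub>F T in at D within CS. T \<in> CS"
    by (simp add: eventually_at_filter)
  ultimately show "\<forall>\<^sub>F T in at D within CS. norm (matrix_function f T $ a $ b
      - matrix_function f D $ a $ b
      - (T - D) $ q $ a $ b * complex_of_real ((f (x b) - f (x a)) / (x b $ q - x a $ q)))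
      \<le> \<epsilon> * norm (T - D)"
  proof eventually_elim
    case (elim T)
    then obtain W y where T: "joint_diagonalization T W y"
      using CS_joint_diagonalization_exists by blast
    define G where "G = matrix_function f T - matrix_function f D"
    define H where "H = (T - D) $ q"
    have FT: "matrix_function f T = diag (\<lambda>i. f (x i)) + G"
      by (simp add: G_def matrix_function_diagonal[OF D])
    have Tq: "T $ q = diag (\<lambda>i. x i $ q) + H"
      by (simp add: H_def D)
    have "a \<noteq> b" "gap \<noteq> 0"
      using ab by (auto simp: gap_def)
    \<comment> \<open>Expanding both products, the terms without \<open>G\<close> and \<open>H\<close> cancel, and those of first order
      carry the differences of the diagonal entries.\<close>
    have "(matrix_function f T ** T $ q) $ a $ b = (T $ q ** matrix_function f T) $ a $ b"
      by (simp add: matrix_function_commutes[OF T])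
    then have "G $ a $ b * complex_of_real gap
        = H $ a $ b * complex_of_real (f (x b) - f (x a)) + ((H ** G) $ a $ b - (G ** H) $ a $ b)"
      unfolding FT Tq
      by (simp add: matrix_add_ldistrib matrix_add_rdistrib matrix_mult_diag_left
          matrix_mult_diag_right gap_def)
        (simp add: diag_def \<open>a \<noteq> b\<close> algebra_simps)
    then have "G $ a $ b - H $ a $ b * complex_of_real ((f (x b) - f (x a)) / gap)
        = ((H ** G) $ a $ b - (G ** H) $ a $ b) / complex_of_real gap"
      using ab by (simp add: gap_def field_simps)
    moreover have "cmod ((H ** G) $ a $ b) \<le> real CARD('n) * (norm (T - D) * \<eta>)"
      "cmod ((G ** H) $ a $ b) \<le> real CARD('n) * (\<eta> * norm (T - D))"
      using elim(1) unfolding G_def H_def by (intro matrix_mult_entry_le tuple_entry_le_norm; blast)+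
    then have "cmod ((H ** G) $ a $ b - (G ** H) $ a $ b) \<le> 2 * real CARD('n) * \<eta> * norm (T - D)"
      by (intro order_trans[OF norm_triangle_ineq4]) (simp add: mult_ac)
    then have "cmod (((H ** G) $ a $ b - (G ** H) $ a $ b) / complex_of_real gap) \<le> \<epsilon> * norm (T - D)"
      using \<open>gap \<noteq> 0\<close> by (simp add: \<eta>_def norm_divide field_simps)
    ultimately have "cmod (G $ a $ b - H $ a $ b * complex_of_real ((f (x b) - f (x a)) / gap))
        \<le> \<epsilon> * norm (T - D)"
      by simp
    then show ?case
      by (simp add: G_def H_def gap_def)
  qed
qed

lemma partial_deriv_has_derivative:
  fixes f :: "real^'d::finite \<Rightarrow> real"
  assumes "(f has_derivative f') (at z)"
  shows "(f has_derivative (\<lambda>v. \<Sum>r\<in>UNIV. partial_deriv r f z * v $ r)) (at z)"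
proof -
  interpret f': bounded_linear f'
    using assms by (rule has_derivative_bounded_linear)
  have partial: "partial_deriv r f z = f' (axis r 1)" for r
  proof -
    have "((\<lambda>h. z + h *\<^sub>R axis r 1) has_derivative (\<lambda>h. h *\<^sub>R axis r 1)) (at (0::real))"
      by (auto intro!: derivative_eq_intros)
    then have "((\<lambda>h. f (z + h *\<^sub>R axis r 1)) has_derivative (\<lambda>h. f' (h *\<^sub>R axis r 1))) (at 0)"
      by (rule has_derivative_compose) (use assms in simp)
    then have "((\<lambda>h. f (z + h *\<^sub>R axis r 1)) has_real_derivative f' (axis r 1)) (at 0)"
      by (simp add: has_field_derivative_def f'.scaleR mult_commute_abs)
    then show ?thesis
      unfolding partial_deriv_def by (rule DERIV_imp_deriv)
  qed
  have "f' v = (\<Sum>r\<in>UNIV. partial_deriv r f z * v $ r)" for v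
  proof -
    have "v = (\<Sum>r\<in>UNIV. v $ r *\<^sub>R axis r 1)"
      using basis_expansion[of v] by (simp add: scalar_mult_eq_scaleR)
    then have "f' v = f' (\<Sum>r\<in>UNIV. v $ r *\<^sub>R axis r 1)"
      by (rule arg_cong)
    also have "\<dots> = (\<Sum>r\<in>UNIV. partial_deriv r f z * v $ r)"
      by (simp add: f'.sum f'.scaleR partial mult.commute)
    finally show ?thesis .
  qed
  then have "f' = (\<lambda>v. \<Sum>r\<in>UNIV. partial_deriv r f z * v $ r)"
    by (rule ext)
  with assms show ?thesis
    by (simp only:)
qed

section \<open>Unitary conjugation of tuples\<close>

lemma adj_mult: "adj (A ** B) = adj B ** adj A"
  by (simp add: adj_def matrix_matrix_mult_def vec_eq_iff mult.commute)

lemma adj_adj: "adj (adj A) = A"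
  by (simp add: adj_def vec_eq_iff)

lemma bounded_linear_conjugation:
  fixes A B :: "complex^'n::finite^'n"
  shows "bounded_linear (\<lambda>X. A ** X ** B)"
proof -
  have "linear (\<lambda>X. A ** X ** B)"
    by (rule linearI) (simp_all add: matrix_add_ldistrib matrix_add_rdistrib matrix_scalar_ac scalar_matrix_assoc)
  then show ?thesis
    by (simp add: linear_conv_bounded_linear)
qed

definition conjugate_tuple :: "complex^'n^'n \<Rightarrow> (complex^'n^'n)^'d \<Rightarrow> (complex^'n^'n)^'d" where
  "conjugate_tuple U S = (\<chi> r. adj U ** S $ r ** U)"

lemma bounded_linear_conjugate_tuple:
  "bounded_linear (conjugate_tuple U :: (complex^'n::finite^'n)^'d::finite \<Rightarrow> _)"
proof -
  interpret bounded_linear "\<lambda>X. adj U ** X ** U"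
    by (rule bounded_linear_conjugation)
  have "linear (conjugate_tuple U :: (complex^'n::finite^'n)^'d::finite \<Rightarrow> _)"
    by (rule linearI) (simp_all add: conjugate_tuple_def vec_eq_iff[where 'b = 'd] add scaleR)
  then show ?thesis
    by (simp add: linear_conv_bounded_linear)
qed

lemma conjugate_tuple_CS:
  assumes U: "unitary U" and S: "S \<in> CS"
  shows "conjugate_tuple U S \<in> CS"
proof -
  have mult: "(adj U ** A ** U) ** (adj U ** B ** U) = adj U ** (A ** B) ** U" for A B
  proof -
    have "(adj U ** A ** U) ** (adj U ** B ** U) = adj U ** A ** (U ** adj U) ** B ** U"
      by (simp add: matrix_mul_assoc)
    also have "\<dots> = adj U ** A ** mat 1 ** B ** U"
      using U by (simp only: unitary_def)
    finally show ?thesis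
      by (simp add: matrix_mul_assoc)
  qed
  have "adj (adj U ** A ** U) = adj U ** adj A ** U" for A
    by (simp add: adj_mult adj_adj matrix_mul_assoc)
  then show ?thesis
    using S by (simp add: CS_def self_adjoint_def conjugate_tuple_def mult)
qed

lemma joint_diagonalization_conjugate_tuple:
  assumes U: "unitary U" and S: "joint_diagonalization S V y"
  shows "joint_diagonalization (conjugate_tuple U S) (adj U ** V) y"
proof -
  have V: "unitary V"
    using S by (simp add: joint_diagonalization_def)
  have "adj (adj U ** V) ** (adj U ** V) = adj V ** (U ** adj U) ** V"
    by (simp add: adj_mult adj_adj matrix_mul_assoc)
  moreover have "(adj U ** V) ** adj (adj U ** V) = adj U ** (V ** adj V) ** U"
    by (simp add: adj_mult adj_adj matrix_mul_assoc)
  ultimately have "unitary (adj U ** V)"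
    using U V by (simp add: unitary_def)
  then show ?thesis
    using S by (simp add: joint_diagonalization_def conjugate_tuple_def adj_mult adj_adj matrix_mul_assoc)
qed

lemma matrix_function_conjugate_tuple:
  assumes U: "unitary U" and S: "S \<in> CS"
  shows "matrix_function f S = U ** matrix_function f (conjugate_tuple U S) ** adj U"
proof -
  obtain V y where V: "joint_diagonalization S V y"
    using CS_joint_diagonalization_exists[OF S] by blast
  have "U ** matrix_function f (conjugate_tuple U S) ** adj U
      = (U ** adj U) ** (V ** diag (\<lambda>i. f (y i)) ** adj V) ** (U ** adj U)"
    by (simp add: matrix_function_eq[OF joint_diagonalization_conjugate_tuple[OF U V]]
        adj_mult adj_adj matrix_mul_assoc)
  then show ?thesis
    using U by (simp add: unitary_def matrix_function_eq[OF V])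
qed

theorem proposition3p5:
  fixes S :: "real \<Rightarrow> (complex^'n::{finite,linorder}^'n::{finite,linorder})^'d::finite"
    and I :: "real set" and t0 :: real
    and \<Omega> :: "(real^'d) set" and f :: "real^'d \<Rightarrow> real"
    and U :: "complex^'n::{finite,linorder}^'n::{finite,linorder}" and x :: "'n::{finite,linorder} \<Rightarrow> real^'d"
    and D \<Gamma> \<Gamma>' :: "(complex^'n::{finite,linorder}^'n::{finite,linorder})^'d" and Y :: "complex^'n::{finite,linorder}^'n::{finite,linorder}"
    and q :: "'n::{finite,linorder} \<Rightarrow> 'n::{finite,linorder} \<Rightarrow> 'd"
  assumes "is_interval I" and "t0 \<in> I"
    and "\<forall>t\<in>I. S t \<in> CS" and "C1_curve_on S I"
    and "open \<Omega>" and "\<forall>t\<in>I. joint_spectrum (S t) \<subseteq> \<Omega>" and "C1_on f \<Omega>"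
    and "unitary U"
    and "\<forall>r. D $ r = adj U ** S t0 $ r ** U"
    and "\<forall>r. D $ r = diag (\<lambda>i. x i $ r)"
    and "\<forall>i j k. i \<le> j \<longrightarrow> j \<le> k \<longrightarrow> x i = x k \<longrightarrow> x j = x i"
    and "\<forall>r. \<Gamma> $ r = adj U ** vector_derivative (\<lambda>t. S t $ r) (at t0 within I) ** U"
    and "\<forall>r i j. \<Gamma>' $ r $ i $ j = (if x i = x j then \<Gamma> $ r $ i $ j else 0)"
    and "\<forall>i j. x i \<noteq> x j \<longrightarrow> x j $ q i j - x i $ q i j \<noteq> 0"
    and "\<forall>i j. Y $ i $ j =
           (if x i \<noteq> x j
            then \<Gamma> $ q i j $ i $ j / complex_of_real (x j $ q i j - x i $ q i j) else 0)"
  shows "((\<lambda>t. matrix_function f (S t)) has_vector_derivative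
           U ** ((\<Sum>r\<in>UNIV. \<Gamma>' $ r ** diag (\<lambda>i. partial_deriv r f (x i)))
                 + commutator Y (matrix_function f D)) ** adj U) (at t0 within I)"
proof (cases "at t0 within I = bot")
  \<comment> \<open>Here \<open>I\<close> is the single point \<open>t0\<close>: the filter is trivial, \<^const>\<open>vector_derivative\<close>
    is unspecified, and every matrix is a derivative.\<close>
  case True
  show ?thesis
    unfolding has_vector_derivative_def has_derivative_within
    using True by (simp add: bounded_linear_scaleR_left)
next
  case nontrivial: False
  note t0 = assms(2) and S = assms(3)
  have U: "unitary U" and D: "\<And>r. D $ r = diag (\<lambda>i. x i $ r)"
    using assms(8,10) by auto
  define T where "T = (\<lambda>t. conjugate_tuple U (S t))"
  have T: "T t \<in> CS" if "t \<in> I" for t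
    using that S by (simp add: T_def conjugate_tuple_CS[OF U])
  have T0: "T t0 = D"
    using assms(9) by (simp add: T_def conjugate_tuple_def vec_eq_iff)
  have "joint_diagonalization (S t0) U x"
  proof -
    have "U ** D $ r ** adj U = (U ** adj U) ** S t0 $ r ** (U ** adj U)" for r
      using assms(9) by (simp add: matrix_mul_assoc)
    then show ?thesis
      using U D by (simp add: joint_diagonalization_def unitary_def)
  qed
  then have "x k \<in> \<Omega>" for k
    using assms(6) t0 joint_spectrum_eq by blast
  then have f: "(f has_derivative (\<lambda>v. \<Sum>r\<in>UNIV. partial_deriv r f (x k) * v $ r)) (at (x k))" for k
    using assms(7) partial_deriv_has_derivative unfolding C1_on_def by blast
  obtain S' where S': "(S has_vector_derivative S') (at t0 within I)"
    using assms(4) t0 unfolding C1_curve_on_def by blast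
  have "vector_derivative (\<lambda>t. S t $ r) (at t0 within I) = S' $ r" for r
    using bounded_linear.has_vector_derivative[OF bounded_linear_vec_nth S'] nontrivial
    by (intro vector_derivative_within) auto
  then have \<Gamma>: "\<Gamma> = conjugate_tuple U S'"
    using assms(12) by (simp add: conjugate_tuple_def vec_eq_iff[where 'b = 'd])
  have T': "(T has_vector_derivative \<Gamma>) (at t0 within I)"
    unfolding T_def \<Gamma>
    by (rule bounded_linear.has_vector_derivative[OF bounded_linear_conjugate_tuple S'])
  define L where "L H = (\<chi> a b. if x a = x b
      then \<Sum>r\<in>UNIV. H $ r $ a $ b * complex_of_real (partial_deriv r f (x b))
      else H $ q a b $ a $ b
        * complex_of_real ((f (x b) - f (x a)) / (x b $ q a b - x a $ q a b)))"
    for H :: "(complex^'n::{finite,linorder}^'n::{finite,linorder})^'d"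
  have L: "(matrix_function f has_derivative L) (at D within CS)"
  proof (intro has_derivative_vec)
    fix a b
    show "((\<lambda>T. matrix_function f T $ a $ b) has_derivative (\<lambda>H. L H $ a $ b)) (at D within CS)"
    proof (cases "x a = x b")
      case True
      then show ?thesis
        using matrix_function_block_entry_has_derivative[OF D f True] by (simp add: L_def)
    next
      case False
      then have "x b $ q a b - x a $ q a b \<noteq> 0"
        using assms(14) by blast
      from matrix_function_offblock_entry_has_derivative[OF D has_derivative_continuous[OF f] this]
      show ?thesis
        using False by (simp add: L_def)
    qed
  qed
  then have "(matrix_function f has_derivative L) (at (T t0) within T ` I)"
    unfolding T0 using T by (intro has_derivative_subset[OF L]) auto
  from vector_derivative_diff_chain_within[OF T' this]
  have "((\<lambda>t. U ** matrix_function f (T t) ** adj U) has_vector_derivative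
      U ** L \<Gamma> ** adj U) (at t0 within I)"
    unfolding o_def by (rule bounded_linear.has_vector_derivative[OF bounded_linear_conjugation])
  then have "((\<lambda>t. matrix_function f (S t)) has_vector_derivative U ** L \<Gamma> ** adj U)
      (at t0 within I)"
    by (rule has_vector_derivative_transform[OF t0, rotated])
      (use S in \<open>simp add: T_def matrix_function_conjugate_tuple[OF U]\<close>)
  moreover have "L \<Gamma> = (\<Sum>r\<in>UNIV. \<Gamma>' $ r ** diag (\<lambda>i. partial_deriv r f (x i)))
      + commutator Y (matrix_function f D)" (is "_ = ?B + ?C")
  proof -
    have "L \<Gamma> $ a $ b = (?B + ?C) $ a $ b" for a b
    proof -
      have B: "?B $ a $ b
          = (\<Sum>r\<in>UNIV. \<Gamma>' $ r $ a $ b * complex_of_real (partial_deriv r f (x b)))"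
        by (simp add: matrix_mult_diag_right)
      have C: "?C $ a $ b = Y $ a $ b * complex_of_real (f (x b) - f (x a))"
        by (simp add: commutator_def matrix_function_diagonal[OF D] matrix_mult_diag_left
            matrix_mult_diag_right right_diff_distrib mult.commute)
      show ?thesis
      proof (cases "x a = x b")
        case True
        then have "Y $ a $ b = 0" "\<Gamma>' $ r $ a $ b = \<Gamma> $ r $ a $ b" for r
          using assms(13,15) by auto
        then show ?thesis
          unfolding vector_add_component B C by (simp add: L_def True)
      next
        case False
        then have "Y $ a $ b = \<Gamma> $ q a b $ a $ b / complex_of_real (x b $ q a b - x a $ q a b)"
            "\<Gamma>' $ r $ a $ b = 0" for r
          using assms(13,15) by auto
        then show ?thesis
          unfolding vector_add_component B C by (simp add: L_def False)
      qed
    qed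
    then show ?thesis
      by (simp add: vec_eq_iff)
  qed
  ultimately show ?thesis
    by simp
qed

end
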